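(* Let $\mathcal{P}$ be a distributed graph problem which has a $\mathsf{ZLOCAL}(r)$ algorithm $A$. When running $A$ on a graph $G=(V,E)$, for each $v\in V$ let $R_v$ be the private random bit string used by node $v$. Then there is a deterministic $\mathsf{SLOCAL}(2r)$ algorithm that assigns values to all $R_v$ such that, when $A$ is run (deterministically) with those values of the $R_v$, it solves $\mathcal{P}$ on $G$.
   Context: A distributed graph problem is posed on a simple undirected $n$-node graph $G=(V,E)$ (the network); each node has a unique $O(\log n)$-bit identifier and possibly a private input, and must output a value; the problem specifies which combinations of graph, inputs and outputs are valid (independently of the identifiers). In the LOCAL model, computation proceeds in synchronous rounds in which each node may send arbitrarily large messages to each neighbor; equivalently, in an $r$-round algorithm each node's output is a function of the initial states (identifiers, inputs, and for randomized algorithms the private random bit strings) of all nodes within distance $r$. In the SLOCAL model with locality $r$, nodes are processed sequentially in an arbitrary (adversarially chosen) order; when a node $v$ is processed, it reads its $r$-hop neighborhood including all information stored there by previously processed nodes, and computes and stores its output (and possibly additional information). $\mathsf{SLOCAL}(t)$ denotes problems solvable by deterministic SLOCAL algorithms with locality $t$. $\mathsf{ZLOCAL}(t)$ denotes problems solvable by a randomized Las Vegas LOCAL algorithm with fixed time complexity $t$, meaning: each node $v$, in addition to its output, outputs a flag $F_v\in\{0,1\}$; whenever $F_v=0$ for all $v$, the outputs solve the problem; and $\sum_{v\in V}\mathbb{E}[F_v]<1$. *)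

theory Defs
  imports "HOL-Probability.Probability" "HOL-Library.Landau_Symbols" "Graph_Theory.Pair_Digraph"
begin

text \<open>Networks are simple undirected finite graphs, i.e. instances of \<^locale>\<open>pair_graph\<close>
  (finite, loop-free, with a symmetric arc relation).\<close>

definition ball_of :: "'v pair_pre_digraph \<Rightarrow> nat \<Rightarrow> 'v \<Rightarrow> 'v set" where
  "ball_of G r v = {u. \<exists>p. pre_digraph.awalk (with_proj G) v p u \<and> length p \<le> r}"

text \<open>The information a node can gather: its own identifier and the subgraph induced by
  its ball, where every node carries its identifier and a local state. Nodes are named by their
  identifiers only, so that an algorithm has no access to the underlying vertices.\<close>

record 's view =
  centre :: nat
  nodes :: "(nat \<times> 's) set"
  links :: "nat rel"

definition view_of ::
  "'v pair_pre_digraph \<Rightarrow> ('v \<Rightarrow> nat) \<Rightarrow> ('v \<Rightarrow> 's) \<Rightarrow> nat \<Rightarrow> 'v \<Rightarrow> 's view" where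
  "view_of G ident st r v =
    \<lparr> centre = ident v,
      nodes = {(ident u, st u) |u. u \<in> ball_of G r v},
      links = {(ident u, ident w) |u w.
        u \<in> ball_of G r v \<and> w \<in> ball_of G r v \<and> (u, w) \<in> parcs G} \<rparr>"

text \<open>A problem says which graphs with private inputs may be posed (a promise, which may be
  trivial) and which outputs are then correct. Neither component sees the identifiers.\<close>

record ('v, 'i, 'o) problem =
  admissible :: "'v pair_pre_digraph \<Rightarrow> ('v \<Rightarrow> 'i) \<Rightarrow> bool"
  valid :: "'v pair_pre_digraph \<Rightarrow> ('v \<Rightarrow> 'i) \<Rightarrow> ('v \<Rightarrow> 'o) \<Rightarrow> bool"

text \<open>The number \<open>b n\<close> is the length in bits of the identifiers in \<open>n\<close>-node networks.\<close>

definition problem_instance ::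
  "(nat \<Rightarrow> nat) \<Rightarrow> ('v, 'i, 'o) problem \<Rightarrow> 'v pair_pre_digraph \<Rightarrow> ('v \<Rightarrow> nat) \<Rightarrow> ('v \<Rightarrow> 'i) \<Rightarrow> bool"
where
  "problem_instance b P G ident x \<longleftrightarrow>
     pair_graph G \<and>
     inj_on ident (pverts G) \<and> (\<forall>v\<in>pverts G. ident v < 2 ^ b (card (pverts G))) \<and>
     x \<in> extensional (pverts G) \<and> admissible P G x"

definition solves ::
  "('v, 'i, 'o) problem \<Rightarrow> 'v pair_pre_digraph \<Rightarrow> ('v \<Rightarrow> 'i) \<Rightarrow> ('v \<Rightarrow> 'o) \<Rightarrow> bool" where
  "solves P G x y \<longleftrightarrow> valid P G x (restrict y (pverts G))"

text \<open>Each node has an unlimited supply of random bits; an algorithm using strings of bounded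
  length only looks at a prefix.\<close>

type_synonym bits = "nat \<Rightarrow> bool"

definition random_bits :: "bits measure" where
  "random_bits = (\<Pi>\<^sub>M i\<in>UNIV. measure_pmf (bernoulli_pmf (1/2)))"

text \<open>A randomized LOCAL algorithm with a flag maps the number of nodes and the view of a node
  to the output and the flag of that node (\<^const>\<open>True\<close> stands for 1).
  The locality also depends on the number of nodes.\<close>

type_synonym ('i, 'o) flagged_local_alg = "nat \<Rightarrow> ('i \<times> bits) view \<Rightarrow> 'o \<times> bool"

definition run_local ::
  "('i, 'o) flagged_local_alg \<Rightarrow> (nat \<Rightarrow> nat) \<Rightarrow> 'v pair_pre_digraph \<Rightarrow> ('v \<Rightarrow> nat) \<Rightarrow> ('v \<Rightarrow> 'i) \<Rightarrow>
   ('v \<Rightarrow> bits) \<Rightarrow> 'v \<Rightarrow> 'o \<times> bool" where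
  "run_local A r G ident x R v =
     (let n = card (pverts G) in A n (view_of G ident (\<lambda>u. (x u, R u)) (r n) v))"

abbreviation local_output where
  "local_output A r G ident x R v \<equiv> fst (run_local A r G ident x R v)"

abbreviation local_flag where
  "local_flag A r G ident x R v \<equiv> snd (run_local A r G ident x R v)"

text \<open>The flags have to be measurable for their expectations to make sense.\<close>

definition zlocal_algorithm ::
  "(nat \<Rightarrow> nat) \<Rightarrow> ('v, 'i, 'o) problem \<Rightarrow> (nat \<Rightarrow> nat) \<Rightarrow> ('i, 'o) flagged_local_alg \<Rightarrow> bool" where
  "zlocal_algorithm b P r A \<longleftrightarrow>
     (\<forall>G ident x. problem_instance b P G ident x \<longrightarrow>
        (let M = (\<Pi>\<^sub>M v\<in>pverts G. random_bits) in
          (\<forall>v\<in>pverts G.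
             (\<lambda>R. local_flag A r G ident x R v) \<in> measurable M (count_space UNIV)) \<and>
          (\<forall>R. (\<forall>v\<in>pverts G. \<not> local_flag A r G ident x R v) \<longrightarrow>
             solves P G x (local_output A r G ident x R)) \<and>
          (\<Sum>v\<in>pverts G. \<integral>R. of_bool (local_flag A r G ident x R v) \<partial>M) < (1::real)))"

text \<open>A deterministic SLOCAL algorithm maps the number of nodes and the view of the node being
  processed to the output of that node and additional information that is stored there. The state
  of a node in the view is its input and, once it has been processed, what is stored there.\<close>

type_synonym ('i, 'o, 'm) slocal_alg =
  "nat \<Rightarrow> ('i \<times> ('o \<times> 'm) option) view \<Rightarrow> 'o \<times> 'm"

definition slocal_step ::
  "('i, 'o, 'm) slocal_alg \<Rightarrow> (nat \<Rightarrow> nat) \<Rightarrow> 'v pair_pre_digraph \<Rightarrow> ('v \<Rightarrow> nat) \<Rightarrow> ('v \<Rightarrow> 'i) \<Rightarrow>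
   'v \<Rightarrow> ('v \<rightharpoonup> 'o \<times> 'm) \<Rightarrow> ('v \<rightharpoonup> 'o \<times> 'm)" where
  "slocal_step B t G ident x v mem =
     (let n = card (pverts G) in
       mem(v \<mapsto> B n (view_of G ident (\<lambda>u. (x u, mem u)) (t n) v)))"

definition slocal_output ::
  "('i, 'o, 'm) slocal_alg \<Rightarrow> (nat \<Rightarrow> nat) \<Rightarrow> 'v pair_pre_digraph \<Rightarrow> ('v \<Rightarrow> nat) \<Rightarrow> ('v \<Rightarrow> 'i) \<Rightarrow>
   'v list \<Rightarrow> 'v \<Rightarrow> 'o" where
  "slocal_output B t G ident x vs v =
     fst (the (fold (slocal_step B t G ident x) vs Map.empty v))"

definition processing_order :: "'v pair_pre_digraph \<Rightarrow> 'v list \<Rightarrow> bool" where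
  "processing_order G vs \<longleftrightarrow> distinct vs \<and> set vs = pverts G"

end

theory Submission
  imports Defs
begin

text \<open>The proof is the method of conditional expectations. When a node \<open>v\<close> is processed, its random
  string is fixed so that the expected number of raised flags, conditioned on all strings fixed so
  far, does not increase. Only flags of nodes within distance \<open>r\<close> of \<open>v\<close> depend on the string of
  \<open>v\<close>, and these flags are determined by what lies within distance \<open>2r\<close> of \<open>v\<close>, so \<open>v\<close> can make the
  choice on its own. At the end all strings are fixed and the number of raised flags is an integer
  below 1. As an algorithm sees identifiers only, expectations are taken over one random string
  for every natural number, a node using the string of its identifier.\<close>

section \<open>Balls in a network and their counterparts on identifiers\<close>

text \<open>A view names nodes by their identifiers, so balls inside it have to be found from its
  \<open>links\<close> alone.\<close>

primrec near :: "'a rel \<Rightarrow> nat \<Rightarrow> 'a \<Rightarrow> 'a set" where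
  "near E 0 i = {i}"
| "near E (Suc k) i = insert i (\<Union>j\<in>E `` {i}. near E k j)"

lemma ball_of_0: "v \<in> pverts G \<Longrightarrow> ball_of G 0 v = {v}"
  by (auto simp: ball_of_def pre_digraph.awalk_def pre_digraph.cas.simps)

text \<open>Splitting off the first arc of a walk gives balls the same recursion as
  \<open>near\<close>.\<close>

lemma (in pair_wf_digraph) ball_of_Suc:
  assumes "v \<in> pverts G"
  shows "ball_of G (Suc k) v = insert v (\<Union>j\<in>parcs G `` {v}. ball_of G k j)"
proof (intro set_eqI iffI)
  fix u assume "u \<in> ball_of G (Suc k) v"
  then obtain p where p: "awalk v p u" "length p \<le> Suc k"
    by (auto simp: ball_of_def)
  then show "u \<in> insert v (\<Union>j\<in>parcs G `` {v}. ball_of G k j)"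
    by (cases p) (auto simp: ball_of_def awalk_simps)
next
  fix u assume u: "u \<in> insert v (\<Union>j\<in>parcs G `` {v}. ball_of G k j)"
  show "u \<in> ball_of G (Suc k) v"
  proof (cases "u = v")
    case True
    then show ?thesis
      using assms by (auto simp: ball_of_def awalk_simps intro!: exI[of _ "[]"])
  next
    case False
    with u obtain j p where "(v, j) \<in> parcs G" "awalk j p u" "length p \<le> k"
      by (auto simp: ball_of_def)
    then show ?thesis
      using assms by (auto simp: ball_of_def awalk_simps intro!: exI[of _ "(v, j) # p"])
  qed
qed

lemma (in pair_wf_digraph) ball_of_subset: "ball_of G k v \<subseteq> pverts G"
  by (auto simp: ball_of_def dest: awalk_last_in_verts)

lemma (in pair_wf_digraph) self_in_ball_of: "v \<in> pverts G \<Longrightarrow> v \<in> ball_of G k v"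
  by (auto simp: ball_of_def awalk_simps intro!: exI[of _ "[]"])

lemma (in pair_wf_digraph) ball_of_trans:
  assumes "u \<in> ball_of G k v" "w \<in> ball_of G l u"
  shows "w \<in> ball_of G (k + l) v"
proof -
  obtain p q where "awalk v p u" "length p \<le> k" "awalk u q w" "length q \<le> l"
    using assms by (auto simp: ball_of_def)
  then have "awalk v (p @ q) w" "length (p @ q) \<le> k + l"
    by auto
  then show ?thesis
    unfolding ball_of_def by blast
qed

text \<open>Undirectedness of the network enters here: a walk can be reversed.\<close>

lemma (in pair_sym_digraph) ball_of_commute:
  assumes "u \<in> ball_of G k v"
  shows "v \<in> ball_of G k u"
proof -
  have "length (rev_path p) = length p" for p :: "('a \<times> 'a) list"
    by (induction p) auto
  moreover obtain p where "awalk v p u" "length p \<le> k"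
    using assms by (auto simp: ball_of_def)
  ultimately have "awalk u (rev_path p) v" "length (rev_path p) \<le> k"
    by simp_all
  then show ?thesis
    unfolding ball_of_def by blast
qed

locale identified_graph = pair_graph G for G :: "'v pair_pre_digraph" +
  fixes ident :: "'v \<Rightarrow> nat"
  assumes inj_ident: "inj_on ident (pverts G)"
begin

text \<open>No walk of length at most \<open>k\<close> from \<open>v\<close> leaves
  \<open>S\<close>, so cutting the graph down to \<open>S\<close> loses nothing. The induction works
  because the \<open>k\<close>-ball of a neighbour lies in the \<open>Suc k\<close>-ball of
  \<open>v\<close>.\<close>

lemma near_induced:
  assumes "S \<subseteq> pverts G" "v \<in> pverts G" "ball_of G k v \<subseteq> S"
  shows "near {(ident u, ident w) |u w. u \<in> S \<and> w \<in> S \<and> (u, w) \<in> parcs G} k (ident v)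
    = ident ` ball_of G k v"
  using assms(2,3)
proof (induction k arbitrary: v)
  case 0
  then show ?case by (simp add: ball_of_0)
next
  case (Suc k)
  let ?E = "{(ident u, ident w) |u w. u \<in> S \<and> w \<in> S \<and> (u, w) \<in> parcs G}"
  have v: "v \<in> S"
    using Suc.prems self_in_ball_of by blast
  have j: "j \<in> S" "ball_of G k j \<subseteq> S" "j \<in> pverts G" if "(v, j) \<in> parcs G" for j
    using Suc.prems that self_in_ball_of[of j k] in_arcsD2[OF that] by (auto simp: ball_of_Suc)
  \<comment> \<open>Injectivity prevents arcs of another node from being mistaken for arcs of
    \<open>v\<close>.\<close>
  have "?E `` {ident v} = ident ` (parcs G `` {v})"
    using v j assms(1) inj_onD[OF inj_ident] by (fastforce simp: image_iff)
  then show ?case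
    using Suc.IH[OF j(3,2)] Suc.prems(1) by (simp add: ball_of_Suc image_UN)
qed

end

section \<open>Simulating a node within the view of another\<close>

text \<open>This is a genuine view of radius \<open>k\<close> only if \<open>V\<close> covers the whole \<open>k\<close>-ball of \<open>i\<close>.\<close>

definition subview ::
  "nat \<Rightarrow> (nat \<Rightarrow> bits) \<Rightarrow> ('i \<times> (bits \<times> 'm) option) view \<Rightarrow> nat \<Rightarrow> ('i \<times> bits) view" where
  "subview k \<xi> V i =
    \<lparr> centre = i,
      nodes = {(j, a, case_option (\<xi> j) fst s) |j a s.
        (j, a, s) \<in> nodes V \<and> j \<in> near (links V) k i},
      links = Restr (links V) (near (links V) k i) \<rparr>"

text \<open>The random assignment conditioned on what is stored so far: stored strings are fixed,
  every other node draws from \<open>\<xi>\<close>.\<close>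

definition fill_bits :: "('v \<Rightarrow> nat) \<Rightarrow> ('v \<rightharpoonup> bits \<times> 'm) \<Rightarrow> (nat \<Rightarrow> bits) \<Rightarrow> 'v \<Rightarrow> bits" where
  "fill_bits ident mem \<xi> v = case_option (\<xi> (ident v)) fst (mem v)"

lemma view_of_cong:
  assumes "\<And>u. u \<in> ball_of G k v \<Longrightarrow> st u = st' u"
  shows "view_of G ident st k v = view_of G ident st' k v"
proof -
  have "{(ident u, st u) |u. u \<in> ball_of G k v} = {(ident u, st' u) |u. u \<in> ball_of G k v}"
    using assms by force
  then show ?thesis by (simp add: view_of_def)
qed

lemma run_local_cong:
  assumes "\<And>u. u \<in> ball_of G (r (card (pverts G))) v \<Longrightarrow> R u = R' u"
  shows "run_local A r G ident x R v = run_local A r G ident x R' v"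
  using view_of_cong[of G "r (card (pverts G))" v "\<lambda>u. (x u, R u)" "\<lambda>u. (x u, R' u)" ident] assms
  by (simp add: run_local_def Let_def)

context identified_graph
begin

text \<open>The source of the doubled locality: the \<open>k\<close>-ball of \<open>u\<close> lies
  in the \<open>2 * k\<close>-ball of \<open>v\<close>, so \<open>v\<close> can rebuild all that
  \<open>u\<close> sees once \<open>\<xi>\<close> supplies the missing strings.\<close>

lemma subview_view_of:
  assumes "u \<in> ball_of G k v"
  shows "subview k \<xi> (view_of G ident (\<lambda>w. (x w, mem w)) (2 * k) v) (ident u)
    = view_of G ident (\<lambda>w. (x w, fill_bits ident mem \<xi> w)) k u"
proof -
  let ?S = "ball_of G (2 * k) v" and ?B = "ball_of G k u"
  let ?E = "{(ident u, ident w) |u w. u \<in> ?S \<and> w \<in> ?S \<and> (u, w) \<in> parcs G}"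
  have S: "?S \<subseteq> pverts G" and u: "u \<in> pverts G"
    using ball_of_subset assms by auto
  have B: "?B \<subseteq> ?S"
    using ball_of_trans[OF assms, of _ k] by (auto simp: mult_2)
  have near: "near ?E k (ident u) = ident ` ?B"
    using near_induced S u B by blast
  \<comment> \<open>By injectivity, selecting nodes through identifiers in the image selects exactly
    the nodes of the ball.\<close>
  have mem_B: "ident w \<in> ident ` ?B \<longleftrightarrow> w \<in> ?B" if "w \<in> ?S" for w
    using inj_on_image_mem_iff[OF inj_ident] that S B by blast
  have "{(j, a, case_option (\<xi> j) fst s) |j a s.
      (j, a, s) \<in> {(ident w, x w, mem w) |w. w \<in> ?S} \<and> j \<in> ident ` ?B}
    = {(ident w, x w, fill_bits ident mem \<xi> w) |w. w \<in> ?B}" (is "?L = ?R")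
  proof
    show "?L \<subseteq> ?R"
    proof
      fix e assume "e \<in> ?L"
      then obtain w where w: "w \<in> ?S" "ident w \<in> ident ` ?B"
        "e = (ident w, x w, case_option (\<xi> (ident w)) fst (mem w))"
        by blast
      then show "e \<in> ?R"
        unfolding fill_bits_def using mem_B by blast
    qed
    show "?R \<subseteq> ?L"
    proof
      fix e assume "e \<in> ?R"
      then obtain w where "w \<in> ?B" "e = (ident w, x w, fill_bits ident mem \<xi> w)"
        by blast
      moreover from this have "(ident w, x w, mem w) \<in> {(ident w, x w, mem w) |w. w \<in> ?S}"
        using B by blast
      ultimately show "e \<in> ?L"
        unfolding fill_bits_def by blast
    qed
  qed
  moreover have "Restr ?E (ident ` ?B)
    = {(ident w, ident w') |w w'. w \<in> ?B \<and> w' \<in> ?B \<and> (w, w') \<in> parcs G}" (is "?L = ?R")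
  proof
    show "?L \<subseteq> ?R"
    proof
      fix e assume "e \<in> ?L"
      then obtain w w' where "e = (ident w, ident w')" "w \<in> ?S" "w' \<in> ?S" "(w, w') \<in> parcs G"
        "ident w \<in> ident ` ?B" "ident w' \<in> ident ` ?B"
        by blast
      then show "e \<in> ?R" using mem_B by blast
    qed
    show "?R \<subseteq> ?L"
      using B by blast
  qed
  ultimately show ?thesis
    by (simp add: subview_def view_of_def near)
qed

end

section \<open>Averaging over random strings\<close>

lemma prob_space_random_bits: "prob_space random_bits"
  unfolding random_bits_def by (intro prob_space_PiM prob_space_measure_pmf)

lemma space_random_bits: "space random_bits = UNIV"
  by (simp add: random_bits_def space_PiM)

text \<open>Indexing by all natural numbers gives a single measure for all networks, which the
  algorithm can use without access to the vertices.\<close>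

definition id_bits :: "(nat \<Rightarrow> bits) measure" where
  "id_bits = (\<Pi>\<^sub>M i\<in>UNIV. random_bits)"

lemma prob_space_id_bits: "prob_space id_bits"
  unfolding id_bits_def by (intro prob_space_PiM prob_space_random_bits)

lemma measurable_fun_upd_id_bits:
  "(\<lambda>(\<rho>, \<xi>). \<xi>(i := \<rho>)) \<in> random_bits \<Otimes>\<^sub>M id_bits \<rightarrow>\<^sub>M id_bits"
  unfolding id_bits_def
  by (intro measurable_PiM_single')
     (auto simp: space_pair_measure space_PiM space_random_bits fun_upd_def if_distrib split_beta)

lemma measurable_fill_bits:
  "(\<lambda>\<xi>. restrict (fill_bits ident mem \<xi>) S) \<in> id_bits \<rightarrow>\<^sub>M (\<Pi>\<^sub>M v\<in>S. random_bits)"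
proof (rule measurable_restrict)
  fix v
  show "(\<lambda>\<xi>. fill_bits ident mem \<xi> v) \<in> id_bits \<rightarrow>\<^sub>M random_bits"
    \<comment> \<open>Either a constant or the coordinate \<open>ident v\<close> of
      \<open>\<xi>\<close>.\<close>
    by (cases "mem v") (auto simp: fill_bits_def id_bits_def space_random_bits)
qed

text \<open>Resampling coordinate \<open>i\<close> independently leaves the measure unchanged. By
  Fubini the right-hand side is therefore the mean of the left-hand side over \<open>\<rho>\<close>,
  and not every value can exceed the mean.\<close>

lemma exists_string_below_expectation:
  fixes h :: "(nat \<Rightarrow> bits) \<Rightarrow> real"
  assumes h: "h \<in> borel_measurable id_bits" and bdd: "\<And>\<xi>. \<bar>h \<xi>\<bar> \<le> c"
  shows "\<exists>\<rho>. (\<integral>\<xi>. h (\<xi>(i := \<rho>)) \<partial>id_bits) \<le> (\<integral>\<xi>. h \<xi> \<partial>id_bits)"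
proof (rule ccontr)
  interpret R: prob_space random_bits by (rule prob_space_random_bits)
  interpret W: prob_space id_bits by (rule prob_space_id_bits)
  interpret RW: pair_prob_space random_bits id_bits ..
  let ?g = "\<lambda>\<rho>. \<integral>\<xi>. h (\<xi>(i := \<rho>)) \<partial>id_bits"
  have upd: "(\<lambda>p. (snd p)(i := fst p)) \<in> random_bits \<Otimes>\<^sub>M id_bits \<rightarrow>\<^sub>M id_bits"
    using measurable_fun_upd_id_bits[of i] by (simp add: split_beta)
  have int: "integrable (random_bits \<Otimes>\<^sub>M id_bits) (\<lambda>p. h ((snd p)(i := fst p)))"
    using bdd by (intro RW.integrable_const_bound[of _ c] AE_I2)
      (auto intro: measurable_compose[OF upd h])
  \<comment> \<open>As \<open>insert i UNIV\<close> is \<open>UNIV\<close>, the fresh string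
    replaces a coordinate that the product already has.\<close>
  have "id_bits = distr (random_bits \<Otimes>\<^sub>M id_bits) id_bits (\<lambda>p. (snd p)(i := fst p))"
    using distr_pair_PiM_eq_PiM[of UNIV "\<lambda>_. random_bits" i] prob_space_random_bits
    by (simp add: id_bits_def case_prod_beta')
  then have "(\<integral>\<xi>. h \<xi> \<partial>id_bits)
    = (\<integral>\<xi>. h \<xi> \<partial>distr (random_bits \<Otimes>\<^sub>M id_bits) id_bits (\<lambda>p. (snd p)(i := fst p)))"
    by simp
  also have "\<dots> = (\<integral>p. h ((snd p)(i := fst p)) \<partial>(random_bits \<Otimes>\<^sub>M id_bits))"
    by (intro integral_distr upd h)
  also have "\<dots> = (\<integral>\<rho>. ?g \<rho> \<partial>random_bits)"
    using RW.integral_fst'[OF int] by simp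
  finally have eq: "(\<integral>\<xi>. h \<xi> \<partial>id_bits) = (\<integral>\<rho>. ?g \<rho> \<partial>random_bits)" .
  assume "\<nexists>\<rho>. ?g \<rho> \<le> (\<integral>\<xi>. h \<xi> \<partial>id_bits)"
  then have "(\<integral>\<xi>. h \<xi> \<partial>id_bits) < (\<integral>\<rho>. ?g \<rho> \<partial>random_bits)"
    using RW.integrable_fst'[OF int] by (intro R.expectation_greater AE_I2) (auto simp: not_le)
  with eq show False by simp
qed

section \<open>The derandomized algorithm\<close>

text \<open>Built from the view alone, as it is part of the algorithm. Flags farther away do not
  depend on the string at the centre, so leaving them out does not affect the comparison of
  expectations.\<close>

definition flag_count ::
  "('i, 'o) flagged_local_alg \<Rightarrow> nat \<Rightarrow> nat \<Rightarrow> ('i \<times> (bits \<times> 'm) option) view \<Rightarrow>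
   (nat \<Rightarrow> bits) \<Rightarrow> real" where
  "flag_count A n k V \<xi> =
    (\<Sum>i\<in>near (links V) k (centre V). of_bool (snd (A n (subview k \<xi> V i))))"

text \<open>Strings stored earlier enter through \<open>subview\<close>, so both integrals are
  conditional expectations. \<open>SOME\<close> is a fixed choice, which keeps the algorithm
  deterministic.\<close>

definition derandomized ::
  "('i, 'o) flagged_local_alg \<Rightarrow> (nat \<Rightarrow> nat) \<Rightarrow> ('i, bits, 'm) slocal_alg" where
  "derandomized A r n V =
    (SOME \<rho>. (\<integral>\<xi>. flag_count A n (r n) V (\<xi>(centre V := \<rho>)) \<partial>id_bits)
        \<le> (\<integral>\<xi>. flag_count A n (r n) V \<xi> \<partial>id_bits),
     undefined)"

text \<open>Before the update \<open>v\<close> reads coordinate \<open>ident v\<close>, and by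
  injectivity no other node of \<open>S\<close> does. Fixing the string of \<open>v\<close> thus
  amounts to overwriting one coordinate.\<close>

lemma fill_bits_fun_upd:
  assumes "inj_on ident S" "v \<in> S" "mem v = None" "w \<in> S"
  shows "fill_bits ident (mem(v \<mapsto> (\<rho>, m))) \<xi> w = fill_bits ident mem (\<xi>(ident v := \<rho>)) w"
  using assms by (auto simp: fill_bits_def inj_on_eq_iff split: option.splits)

context identified_graph
begin

text \<open>What \<open>v\<close> computes from its view is the true number of flags in its ball;
  injectivity turns the sum over identifiers into one over nodes.\<close>

lemma flag_count_view_of:
  assumes "v \<in> pverts G" "n = card (pverts G)"
  shows "flag_count A n (r n) (view_of G ident (\<lambda>w. (x w, mem w)) (2 * r n) v) \<xi>
    = (\<Sum>u\<in>ball_of G (r n) v. of_bool (local_flag A r G ident x (fill_bits ident mem \<xi>) u))"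
proof -
  let ?V = "view_of G ident (\<lambda>w. (x w, mem w)) (2 * r n) v"
  have "ball_of G (r n) v \<subseteq> ball_of G (2 * r n) v"
    using ball_of_trans[OF self_in_ball_of[OF assms(1), of "r n"], of _ "r n"]
    by (auto simp: mult_2)
  then have near: "near (links ?V) (r n) (centre ?V) = ident ` ball_of G (r n) v"
    using near_induced[OF ball_of_subset assms(1)] by (simp add: view_of_def)
  have "inj_on ident (ball_of G (r n) v)"
    using inj_on_subset[OF inj_ident ball_of_subset] .
  then show ?thesis
    by (simp add: flag_count_def near sum.reindex subview_view_of run_local_def Let_def
        flip: assms(2))
qed

end

section \<open>The conditional expectation of the number of flags\<close>

locale zlocal_instance = identified_graph G ident
  for G :: "'v pair_pre_digraph" and ident +
  fixes A :: "('i, 'o) flagged_local_alg" and r :: "nat \<Rightarrow> nat" and x :: "'v \<Rightarrow> 'i"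
  assumes flag_measurable: "v \<in> pverts G \<Longrightarrow>
      (\<lambda>R. local_flag A r G ident x R v)
        \<in> (\<Pi>\<^sub>M v\<in>pverts G. random_bits) \<rightarrow>\<^sub>M count_space UNIV"
    and expected_flags: "(\<Sum>v\<in>pverts G.
      \<integral>R. of_bool (local_flag A r G ident x R v) \<partial>(\<Pi>\<^sub>M v\<in>pverts G. random_bits)) < (1::real)"
begin

abbreviation "rad \<equiv> r (card (pverts G))"

definition flag :: "('v \<Rightarrow> bits) \<Rightarrow> 'v \<Rightarrow> real" where
  "flag R v = of_bool (local_flag A r G ident x R v)"

text \<open>The potential of the argument: the expected number of flags given the strings in
  \<open>mem\<close>.\<close>

definition risk :: "('v \<rightharpoonup> bits \<times> 'm) \<Rightarrow> real" where
  "risk mem = (\<Sum>v\<in>pverts G. \<integral>\<xi>. flag (fill_bits ident mem \<xi>) v \<partial>id_bits)"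

lemma flag_cong:
  "(\<And>u. u \<in> ball_of G rad v \<Longrightarrow> R u = R' u) \<Longrightarrow> flag R v = flag R' v"
  unfolding flag_def by (simp cong: run_local_cong)

text \<open>Bridges \<open>fill_bits\<close>, a total function, and the product measure, which lives
  on extensional functions.\<close>

lemma flag_restrict: "flag (restrict R (pverts G)) v = flag R v"
  using ball_of_subset by (intro flag_cong) auto

lemma flag_borel:
  assumes "v \<in> pverts G"
  shows "(\<lambda>R. flag R v) \<in> borel_measurable (\<Pi>\<^sub>M v\<in>pverts G. random_bits)"
  using measurable_compose[OF flag_measurable[OF assms], of of_bool borel] by (simp add: flag_def)

lemma flag_fill_bits_borel:
  assumes "v \<in> pverts G"
  shows "(\<lambda>\<xi>. flag (fill_bits ident mem \<xi>) v) \<in> borel_measurable id_bits"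
  using measurable_compose[OF measurable_fill_bits flag_borel[OF assms]]
  by (simp add: flag_restrict)

lemma integrable_flag:
  assumes "v \<in> pverts G"
  shows "integrable id_bits (\<lambda>\<xi>. flag (fill_bits ident mem \<xi>) v)"
proof -
  interpret prob_space id_bits by (rule prob_space_id_bits)
  show ?thesis
    using flag_fill_bits_borel[OF assms]
    by (intro integrable_const_bound[of _ 1] AE_I2) (auto simp: flag_def)
qed

text \<open>With nothing stored, each node reads the coordinate of its own identifier. These
  coordinates are distinct, so the strings of the nodes are distributed as in
  \<open>expected_flags\<close>.\<close>

lemma risk_empty: "risk (Map.empty :: 'v \<rightharpoonup> bits \<times> 'm) < 1"
proof -
  let ?none = "Map.empty :: 'v \<rightharpoonup> bits \<times> 'm"
  let ?M = "\<Pi>\<^sub>M v\<in>pverts G. random_bits"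
  have "distr id_bits ?M (\<lambda>\<xi>. restrict (fill_bits ident ?none \<xi>) (pverts G)) = ?M"
    using distr_PiM_reindex[of UNIV "\<lambda>_. random_bits" ident "pverts G"]
      prob_space_random_bits inj_ident
    by (simp add: id_bits_def fill_bits_def[abs_def])
  then have "(\<integral>R. flag R v \<partial>?M)
    = (\<integral>\<xi>. flag (restrict (fill_bits ident ?none \<xi>) (pverts G)) v \<partial>id_bits)"
    if "v \<in> pverts G" for v
    using integral_distr[OF measurable_fill_bits flag_borel[OF that]] by metis
  then have "risk ?none = (\<Sum>v\<in>pverts G. \<integral>R. flag R v \<partial>?M)"
    unfolding risk_def by (intro sum.cong) (simp_all add: flag_restrict)
  then show ?thesis
    using expected_flags by (simp add: flag_def)
qed

text \<open>The choice of \<open>v\<close> does not increase the expected number of flags in its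
  ball, and the flags outside do not depend on that choice.\<close>

lemma risk_step:
  fixes mem :: "'v \<rightharpoonup> bits \<times> 'm"
  assumes v: "v \<in> pverts G" and None: "mem v = None"
  shows "risk (slocal_step (derandomized A r) (\<lambda>n. 2 * r n) G ident x v mem) \<le> risk mem"
proof -
  define n where "n = card (pverts G)"
  define V where "V = view_of G ident (\<lambda>w. (x w, mem w)) (2 * r n) v"
  define B where "B = ball_of G rad v"
  obtain \<rho> m where \<rho>: "derandomized A r n V = (\<rho>, m)"
    by fastforce
  define mem' where "mem' = mem(v \<mapsto> (\<rho>, m))"
  have step: "slocal_step (derandomized A r) (\<lambda>n. 2 * r n) G ident x v mem = mem'"
    using \<rho> by (simp add: slocal_step_def mem'_def V_def n_def Let_def)
  have B: "B \<subseteq> pverts G" and fin: "finite B"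
    using ball_of_subset finite_subset[OF _ pair_finite_verts] by (auto simp: B_def)
  have count: "flag_count A n (r n) V \<xi> = (\<Sum>u\<in>B. flag (fill_bits ident mem \<xi>) u)" for \<xi>
    using flag_count_view_of[OF v n_def] by (simp add: V_def B_def n_def flag_def)
  have upd: "flag (fill_bits ident mem' \<xi>) u = flag (fill_bits ident mem (\<xi>(ident v := \<rho>))) u"
    for \<xi> u
    using fill_bits_fun_upd[of ident "pverts G" v mem, OF inj_ident v None]
      subsetD[OF ball_of_subset[of rad u]]
    by (intro flag_cong) (simp add: mem'_def)
  \<comment> \<open>By symmetry of distance, \<open>v\<close> is not in the ball of
    \<open>u\<close>.\<close>
  have outside: "flag (fill_bits ident mem' \<xi>) u = flag (fill_bits ident mem \<xi>) u"
    if "u \<notin> B" for \<xi> u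
    using that ball_of_commute[of v rad u]
    by (intro flag_cong) (auto simp: mem'_def fill_bits_def B_def)
  \<comment> \<open>Ensures that the \<open>SOME\<close> in \<open>derandomized\<close> picks a
    string with the desired property.\<close>
  have "\<exists>\<rho>. (\<integral>\<xi>. flag_count A n (r n) V (\<xi>(ident v := \<rho>)) \<partial>id_bits)
      \<le> (\<integral>\<xi>. flag_count A n (r n) V \<xi> \<partial>id_bits)"
  proof (rule exists_string_below_expectation)
    show "flag_count A n (r n) V \<in> borel_measurable id_bits"
      using B flag_fill_bits_borel unfolding count[abs_def] by (intro borel_measurable_sum) blast
    have "\<bar>\<Sum>u\<in>B. flag (fill_bits ident mem \<xi>) u\<bar> \<le> (\<Sum>u\<in>B. 1)" for \<xi>
      by (intro order_trans[OF sum_abs] sum_mono) (auto simp: flag_def)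
    then show "\<bar>flag_count A n (r n) V \<xi>\<bar> \<le> card B" for \<xi>
      by (simp add: count)
  qed
  moreover have "centre V = ident v"
    by (simp add: V_def view_of_def)
  moreover have "\<rho> = (SOME \<rho>. (\<integral>\<xi>. flag_count A n (r n) V (\<xi>(centre V := \<rho>)) \<partial>id_bits)
      \<le> (\<integral>\<xi>. flag_count A n (r n) V \<xi> \<partial>id_bits))"
    using \<rho> by (simp add: derandomized_def)
  ultimately have "(\<integral>\<xi>. flag_count A n (r n) V (\<xi>(ident v := \<rho>)) \<partial>id_bits)
      \<le> (\<integral>\<xi>. flag_count A n (r n) V \<xi> \<partial>id_bits)"
    using someI_ex[of "\<lambda>\<rho>. (\<integral>\<xi>. flag_count A n (r n) V (\<xi>(ident v := \<rho>)) \<partial>id_bits)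
      \<le> (\<integral>\<xi>. flag_count A n (r n) V \<xi> \<partial>id_bits)"] by simp
  then have "(\<integral>\<xi>. (\<Sum>u\<in>B. flag (fill_bits ident mem' \<xi>) u) \<partial>id_bits)
      \<le> (\<integral>\<xi>. (\<Sum>u\<in>B. flag (fill_bits ident mem \<xi>) u) \<partial>id_bits)"
    by (simp add: count upd)
  then have "(\<Sum>u\<in>B. \<integral>\<xi>. flag (fill_bits ident mem' \<xi>) u \<partial>id_bits)
      \<le> (\<Sum>u\<in>B. \<integral>\<xi>. flag (fill_bits ident mem \<xi>) u \<partial>id_bits)"
    using B by (simp add: Bochner_Integration.integral_sum integrable_flag subset_iff)
  then have "risk mem' \<le> risk mem"
    unfolding risk_def sum.subset_diff[OF B pair_finite_verts]
    by (simp add: outside)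
  then show ?thesis
    by (simp add: step)
qed

lemma risk_fold:
  assumes "distinct vs" "set vs \<subseteq> pverts G"
    and "\<And>v. v \<in> set vs \<Longrightarrow> mem v = None"
  shows "risk (fold (slocal_step (derandomized A r) (\<lambda>n. 2 * r n) G ident x) vs mem) \<le> risk mem"
  using assms
proof (induction vs arbitrary: mem)
  case Nil
  then show ?case by simp
next
  case (Cons v vs)
  let ?step = "slocal_step (derandomized A r) (\<lambda>n. 2 * r n) G ident x"
  have "risk (fold ?step vs (?step v mem)) \<le> risk (?step v mem)"
    \<comment> \<open>Distinctness keeps the remaining nodes unprocessed after this step.\<close>
    using Cons.prems by (intro Cons.IH) (auto simp: slocal_step_def Let_def)
  also have "\<dots> \<le> risk mem"
    using Cons.prems by (intro risk_step) auto
  finally show ?case by simp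
qed

text \<open>Once all nodes are processed nothing is drawn from \<open>\<xi>\<close>, so
  \<open>risk\<close> integrates a constant and equals the actual number of flags. Each flag is 0 or
  1 and bounded by this total, which is below 1.\<close>

lemma no_flag:
  assumes "processing_order G vs" "v \<in> pverts G"
  shows "\<not> local_flag A r G ident x
    (slocal_output (derandomized A r :: ('i, bits, 'm) slocal_alg) (\<lambda>n. 2 * r n) G ident x vs) v"
proof -
  interpret prob_space id_bits by (rule prob_space_id_bits)
  let ?step = "slocal_step (derandomized A r :: ('i, bits, 'm) slocal_alg)
    (\<lambda>n. 2 * r n) G ident x"
  let ?R = "slocal_output (derandomized A r :: ('i, bits, 'm) slocal_alg)
    (\<lambda>n. 2 * r n) G ident x vs"
  define mem where "mem = fold ?step vs Map.empty"
  have vs: "distinct vs" "set vs = pverts G"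
    using assms(1) by (auto simp: processing_order_def)
  have "dom (fold ?step us m) = dom m \<union> set us" for us m
    by (induction us arbitrary: m) (auto simp: slocal_step_def Let_def)
  then have dom: "dom mem = pverts G"
    by (simp add: mem_def vs)
  then have "fill_bits ident mem \<xi> u = ?R u" if "u \<in> pverts G" for \<xi> u
    using that domD[of u mem] by (auto simp: fill_bits_def slocal_output_def mem_def[symmetric])
  then have "flag (fill_bits ident mem \<xi>) u = flag ?R u" for \<xi> u
    using ball_of_subset by (intro flag_cong) blast
  then have "risk mem = (\<Sum>u\<in>pverts G. flag ?R u)"
    by (simp add: risk_def prob_space)
  moreover have "risk mem < 1"
    unfolding mem_def
    by (rule le_less_trans[OF risk_fold[of vs Map.empty] risk_empty]) (simp_all add: vs)
  moreover have "flag ?R v \<le> (\<Sum>u\<in>pverts G. flag ?R u)"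
    using assms(2) pair_finite_verts by (intro member_le_sum) (auto simp: flag_def)
  ultimately have "flag ?R v < 1"
    by simp
  then show ?thesis
    by (auto simp: flag_def)
qed

end

theorem theorem3p1:
  fixes P :: "('v, 'i, 'o) problem"
    and A :: "('i, 'o) flagged_local_alg"
    and r b :: "nat \<Rightarrow> nat"
  assumes "(\<lambda>n. real (b n)) \<in> O(\<lambda>n. log 2 (real n))"
    and "zlocal_algorithm b P r A"
  shows "\<exists>B :: ('i, bits, 'm) slocal_alg.
    \<forall>G ident x vs. problem_instance b P G ident x \<and> processing_order G vs \<longrightarrow>
      solves P G x
        (local_output A r G ident x (slocal_output B (\<lambda>n. 2 * r n) G ident x vs))"
proof (intro exI[of _ "derandomized A r"] allI impI, elim conjE)
  fix G ident x vs
  assume inst: "problem_instance b P G ident x" and vs: "processing_order G vs"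
  interpret pair_graph G
    using inst by (simp add: problem_instance_def)
  interpret zlocal_instance G ident A r x
    using inst assms(2)
    by unfold_locales (auto simp: problem_instance_def zlocal_algorithm_def Let_def)
  show "solves P G x (local_output A r G ident x
    (slocal_output (derandomized A r :: ('i, bits, 'm) slocal_alg) (\<lambda>n. 2 * r n) G ident x vs))"
    \<comment> \<open>The correctness clause of \<open>zlocal_algorithm\<close> holds for every
      assignment of strings, in particular for the computed one, which raises no flag.\<close>
    using assms(2) inst no_flag[OF vs] unfolding zlocal_algorithm_def Let_def by blast
qed

end
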